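(* Let $(X,\mathcal A,\mu)$ be a measurable space with a non-zero $\sigma$-finite measure $\mu$, let $\xi:X\to X$ be measurable, and suppose that the distribution of $\xi$ is absolutely continuous with respect to $\mu$ with Radon--Nikodym derivative $h$, i.e. $\mu\{y:\xi(y)\in E\}=\int_E h(x)\,\mu(dx)$ for all $E\in\mathcal A$. Let $\psi\in\Psi(A,B)$ with $1\le A<B\le\infty$ and $\theta\in\Psi(a,b)$ with $1\le a<b\le\infty$, and suppose $h\in G\theta$. Define $$\nu(p)=(\psi\odot\theta)(p):=\inf_{\alpha>1}\left\{\psi(\alpha p)\cdot\left[\|h\|G\theta\cdot\theta\left(\frac{\alpha}{\alpha-1}\right)\right]^{1/p}\right\},$$ and suppose that $\nu(p)$ is finite for all $p$ in some non-empty interval $(c,d)$, $1\le c<d\le\infty$. Then for every $f\in G\psi$ the function $U_\xi[f](x)=f(\xi(x))$ satisfies $$\|U_\xi[f]\|G(\psi\odot\theta)\le\|f\|G\psi .$$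
   Context: For a measurable function $f:X\to\mathbb R$ write $|f|_p=\left[\int_X|f(x)|^p\,\mu(dx)\right]^{1/p}$. For $1\le A<B\le\infty$, $\Psi(A,B)$ denotes the set of all continuous positive functions $\psi$ on the open interval $(A,B)$ with $\inf_{p\in(A,B)}\psi(p)>0$; one writes $\operatorname{supp}(\psi)=(A,B)$, and $\psi(p)$ is formally set equal to $+\infty$ for $p$ outside this interval. The Grand Lebesgue Space $G\psi=G(\psi)=G(\psi;A,B)$ consists of all measurable $f:X\to\mathbb R$ with finite norm $$\|f\|G\psi=\sup_{p\in(A,B)}\frac{|f|_p}{\psi(p)} .$$ The norm $\|g\|G(\psi\odot\theta)$ is defined by the same formula, $\|g\|G(\psi\odot\theta)=\sup_{p\in(c,d)}|g|_p/\nu(p)$. The composition operator generated by $\xi$ is $U_\xi[f](x)=f(\xi(x))$. *)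

theory Defs
  imports "HOL-Analysis.Analysis"
begin

(* The open interval with real left endpoint A and right endpoint B in (A, \<infinity>]. *)
definition exp_interval :: "real \<Rightarrow> ereal \<Rightarrow> real set" where
  "exp_interval A B = {p. A < p \<and> ereal p < B}"

(* x^r for x in [0,\<infinity>]. Only used for exponents r > 0, where \<infinity>^r = \<infinity> and 0^r = 0. *)
definition ennreal_powr :: "ennreal \<Rightarrow> real \<Rightarrow> ennreal" where
  "ennreal_powr x r = (if x = \<infinity> then \<infinity> else ennreal (enn2real x powr r))"

definition Lp_norm :: "'a measure \<Rightarrow> real \<Rightarrow> ('a \<Rightarrow> real) \<Rightarrow> ennreal" where
  "Lp_norm M p f = ennreal_powr (\<integral>\<^sup>+x. ennreal (\<bar>f x\<bar> powr p) \<partial>M) (1 / p)"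

definition Psi :: "real \<Rightarrow> ereal \<Rightarrow> (real \<Rightarrow> real) set" where
  "Psi A B = {\<psi>. continuous_on (exp_interval A B) \<psi> \<and>
                  (\<forall>p\<in>exp_interval A B. 0 < \<psi> p) \<and>
                  0 < (INF p\<in>exp_interval A B. \<psi> p)}"

(* A function on (A,B), formally continued by +\<infinity> outside its support; the values of
   \<psi> :: real => real outside (A,B) are irrelevant. *)
definition extend_infty :: "real \<Rightarrow> ereal \<Rightarrow> (real \<Rightarrow> real) \<Rightarrow> real \<Rightarrow> ennreal" where
  "extend_infty A B \<psi> p = (if p \<in> exp_interval A B then ennreal (\<psi> p) else \<infinity>)"

(* The weight w is [0,\<infinity>]-valued so that the same formula covers both G(\<psi>;A,B)
   and G(\<psi> \<odot> \<theta>), whose weight is an infimum of extended values. *)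
definition GL_norm :: "'a measure \<Rightarrow> real \<Rightarrow> ereal \<Rightarrow> (real \<Rightarrow> ennreal) \<Rightarrow> ('a \<Rightarrow> real) \<Rightarrow> ennreal" where
  "GL_norm M A B w f = (SUP p\<in>exp_interval A B. Lp_norm M p f / w p)"

definition G_norm :: "'a measure \<Rightarrow> real \<Rightarrow> ereal \<Rightarrow> (real \<Rightarrow> real) \<Rightarrow> ('a \<Rightarrow> real) \<Rightarrow> ennreal" where
  "G_norm M A B \<psi> f = GL_norm M A B (extend_infty A B \<psi>) f"

definition G_space :: "'a measure \<Rightarrow> real \<Rightarrow> ereal \<Rightarrow> (real \<Rightarrow> real) \<Rightarrow> ('a \<Rightarrow> real) set" where
  "G_space M A B \<psi> = {f \<in> borel_measurable M. G_norm M A B \<psi> f < \<infinity>}"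

(* The function \<psi> \<odot> \<theta>, with H in the role of the norm of h in G\<theta>. *)
definition odot :: "real \<Rightarrow> ereal \<Rightarrow> (real \<Rightarrow> real) \<Rightarrow> real \<Rightarrow> ereal \<Rightarrow> (real \<Rightarrow> real) \<Rightarrow> ennreal \<Rightarrow> real \<Rightarrow> ennreal" where
  "odot A B \<psi> a b \<theta> H p =
     (INF \<alpha>\<in>{1<..}. extend_infty A B \<psi> (\<alpha> * p) *
        ennreal_powr (H * extend_infty a b \<theta> (\<alpha> / (\<alpha> - 1))) (1 / p))"

definition composition_op :: "('a \<Rightarrow> 'a) \<Rightarrow> ('a \<Rightarrow> real) \<Rightarrow> 'a \<Rightarrow> real" where
  "composition_op \<xi> f = (\<lambda>x. f (\<xi> x))"

end

theory Submission
  imports Defs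
begin

text \<open>
  For every \<open>\<alpha> > 1\<close> with conjugate exponent \<open>\<alpha> / (\<alpha> - 1)\<close>, change of variables and
  Hoelder's inequality give

    \<open>\<bar>f \<circ> \<xi>\<bar>\<^sub>p = (\<integral> \<bar>f\<bar>\<^sup>p h d\<mu>)\<^bsup>1/p\<^esup> \<le> \<bar>f\<bar>\<^bsub>\<alpha> p\<^esub> * \<bar>h\<bar>\<^bsub>\<alpha>/(\<alpha>-1)\<^esub>\<^bsup>1/p\<^esup>\<close>

  (\<open>Lp_norm_composition_op_le\<close>). If both exponents lie in the supports of the weights, each
  norm on the right is at most the Grand Lebesgue norm times the weight at that exponent, so \<open>\<bar>f \<circ> \<xi>\<bar>\<^sub>p\<close> is at most \<open>\<parallel>f\<parallel>\<close> times the term of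
  index \<open>\<alpha>\<close> in the infimum that defines \<open>\<psi> \<odot> \<theta>\<close>. Taking the infimum over \<open>\<alpha>\<close>, dividing
  by it and taking the supremum over \<open>p\<close> gives the theorem.

  The delicate points are the conventions \<open>0 * \<infinity> = 0\<close> and \<open>x / 0 = \<infinity>\<close> for \<open>x > 0\<close>. An index \<open>\<alpha>\<close> for
  which one exponent leaves its support should contribute \<open>\<infinity>\<close>, and this fails if the other
  factor vanishes. It does not vanish: the weights are positive on their supports, and
  \<open>\<parallel>h\<parallel> = 0\<close> would make \<open>h\<close> vanish almost everywhere, so that
  \<open>\<mu>(X) = \<integral> h d\<mu> = 0\<close>, while \<open>\<mu>\<close> is nonzero. The quotient by the infimum is treated in
  \<open>ennreal_divide_INF_le\<close>.
\<close>

section \<open>Powers and quotients of extended nonnegative numbers\<close>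

lemma ennreal_powr_0: "ennreal_powr 0 r = 0"
  by (simp add: ennreal_powr_def)

lemma ennreal_powr_top: "ennreal_powr top r = top"
  by (simp add: ennreal_powr_def infinity_ennreal_def)

lemma ennreal_powr_ennreal: "0 \<le> x \<Longrightarrow> ennreal_powr (ennreal x) r = ennreal (x powr r)"
  by (simp add: ennreal_powr_def)

lemma ennreal_powr_eq_0_iff: "ennreal_powr x r = 0 \<longleftrightarrow> x = 0"
  by (cases x) (auto simp: ennreal_powr_ennreal ennreal_powr_top)

lemma ennreal_powr_eq_top_iff: "ennreal_powr x r = top \<longleftrightarrow> x = top"
  by (cases x) (auto simp: ennreal_powr_ennreal ennreal_powr_top)

lemma ennreal_powr_mono:
  assumes "0 \<le> r" "x \<le> y"
  shows "ennreal_powr x r \<le> ennreal_powr y r"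
proof (cases y)
  case (real b)
  moreover obtain a where "x = ennreal a" "0 \<le> a"
    using assms(2) real by (cases x) (auto simp: top_unique)
  ultimately show ?thesis
    using assms by (auto simp: ennreal_powr_ennreal intro!: ennreal_leI powr_mono2)
qed (simp add: ennreal_powr_top)

lemma ennreal_powr_mult: "ennreal_powr (x * y) r = ennreal_powr x r * ennreal_powr y r"
proof (cases x; cases y)
  fix a b assume "0 \<le> a" "x = ennreal a" "0 \<le> b" "y = ennreal b"
  then show ?thesis
    by (simp add: ennreal_powr_ennreal powr_mult flip: ennreal_mult)
qed (auto simp: ennreal_powr_top ennreal_mult_top ennreal_top_mult ennreal_powr_0
       ennreal_powr_ennreal)

lemma ennreal_powr_powr: "ennreal_powr (ennreal_powr x r) s = ennreal_powr x (r * s)"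
  by (cases x) (auto simp: ennreal_powr_ennreal ennreal_powr_top powr_powr)

text \<open>For \<open>F > 0\<close>, the bounds say that \<open>L / F\<close> is a lower bound of the terms, the infinite ones
  included, hence of their infimum. For \<open>F = 0\<close> the product with an infinite term is \<open>0\<close>, so
  the bound can fail at such terms and is asked for at finite ones only; finiteness of the
  infimum provides a finite term, which forces \<open>L = 0\<close>.\<close>

lemma ennreal_divide_INF_le:
  fixes f :: "'i \<Rightarrow> ennreal"
  assumes "(INF i\<in>I. f i) < top" "F < top"
    and bound: "\<And>i. i \<in> I \<Longrightarrow> f i < top \<Longrightarrow> L \<le> F * f i"
  shows "L / (INF i\<in>I. f i) \<le> F"
proof (cases "F = 0")
  case True
  obtain i where "i \<in> I" "f i < top"
    using assms(1) by (auto simp: INF_less_iff)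
  then have "L = 0"
    using bound True by fastforce
  then show ?thesis by simp
next
  case False
  have "L / F \<le> f i" if "i \<in> I" for i
  proof (cases "f i < top")
    case True
    then show ?thesis
      using bound[OF that True] False
      by (intro divide_le_posI_ennreal) (auto simp: zero_less_iff_neq_zero mult.commute)
  qed (simp add: less_top[symmetric])
  then have "L / F \<le> (INF i\<in>I. f i)"
    by (rule INF_greatest)
  then have "L / F * F \<le> (INF i\<in>I. f i) * F"
    by (rule mult_right_mono) simp
  moreover have "L / F * F = L"
    using False assms(2) by (simp add: ennreal_divide_times)
  ultimately have "L \<le> (INF i\<in>I. f i) * F"
    by simp
  then show ?thesis
    by (cases "(INF i\<in>I. f i) = 0")
       (auto intro!: divide_le_posI_ennreal simp: zero_less_iff_neq_zero mult.commute)
qed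

section \<open>Lebesgue norms\<close>

lemma nn_integral_powr_eq_Lp_norm_powr:
  assumes "p \<noteq> 0"
  shows "(\<integral>\<^sup>+x. ennreal (\<bar>f x\<bar> powr p) \<partial>M) = ennreal_powr (Lp_norm M p f) p"
  using assms unfolding Lp_norm_def ennreal_powr_powr
  by (cases "\<integral>\<^sup>+x. ennreal (\<bar>f x\<bar> powr p) \<partial>M")
     (auto simp: ennreal_powr_ennreal ennreal_powr_top)

lemma Lp_norm_eq_0_iff:
  assumes "f \<in> borel_measurable M"
  shows "Lp_norm M p f = 0 \<longleftrightarrow> (AE x in M. f x = 0)"
proof -
  have "Lp_norm M p f = 0 \<longleftrightarrow> (AE x in M. ennreal (\<bar>f x\<bar> powr p) = 0)"
    unfolding Lp_norm_def ennreal_powr_eq_0_iff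
    using assms by (intro nn_integral_0_iff_AE) simp
  then show ?thesis
    by simp
qed

lemma Lp_norm_abs_powr:
  assumes "p \<noteq> 0" "s \<noteq> 0"
  shows "Lp_norm M s (\<lambda>x. \<bar>f x\<bar> powr p) = ennreal_powr (Lp_norm M (s * p) f) p"
  using assms by (simp add: Lp_norm_def ennreal_powr_powr powr_powr mult.commute)

text \<open>Hoelder's inequality, by integrating Young's inequality for \<open>u\<close> and \<open>v\<close> after
  normalising both to norm one.\<close>

lemma nn_integral_mult_le_Lp_norm:
  assumes [measurable]: "u \<in> borel_measurable M" "v \<in> borel_measurable M"
    and pq: "1 < p" "1 < q" "1 / p + 1 / q = 1"
  shows "(\<integral>\<^sup>+x. ennreal \<bar>u x * v x\<bar> \<partial>M) \<le> Lp_norm M p u * Lp_norm M q v"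
proof (cases "Lp_norm M p u = 0 \<or> Lp_norm M q v = 0")
  case True
  then have "AE x in M. ennreal \<bar>u x * v x\<bar> = 0"
    by (auto simp: Lp_norm_eq_0_iff)
  then have "(\<integral>\<^sup>+x. ennreal \<bar>u x * v x\<bar> \<partial>M) = 0"
    by (subst nn_integral_0_iff_AE) auto
  then show ?thesis
    by simp
next
  case nonzero: False
  show ?thesis
  proof (cases "Lp_norm M p u = top \<or> Lp_norm M q v = top")
    case True
    then show ?thesis
      using nonzero by (auto simp: ennreal_mult_eq_top_iff)
  next
    case False
    then obtain U V where UV: "Lp_norm M p u = ennreal U" "Lp_norm M q v = ennreal V"
      "0 < U" "0 < V"
      using nonzero by (cases "Lp_norm M p u"; cases "Lp_norm M q v") (auto simp: less_le)
    have intU: "(\<integral>\<^sup>+x. ennreal (\<bar>u x\<bar> powr p) \<partial>M) = ennreal (U powr p)"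
      and intV: "(\<integral>\<^sup>+x. ennreal (\<bar>v x\<bar> powr q) \<partial>M) = ennreal (V powr q)"
      using UV pq by (simp_all add: nn_integral_powr_eq_Lp_norm_powr ennreal_powr_ennreal)
    \<comment> \<open>The coefficients that turn Young's inequality for \<open>\<bar>u\<bar> / U\<close> and \<open>\<bar>v\<bar> / V\<close>
        into a bound for \<open>\<bar>u v\<bar>\<close>.\<close>
    define a b where "a = U * V / (p * U powr p)" and "b = U * V / (q * V powr q)"
    have ab: "0 \<le> a" "0 \<le> b"
      using UV pq by (auto simp: a_def b_def)
    have "\<bar>u x * v x\<bar> \<le> a * \<bar>u x\<bar> powr p + b * \<bar>v x\<bar> powr q" for x
    proof -
      have "(\<bar>u x\<bar> / U) * (\<bar>v x\<bar> / V) \<le> (\<bar>u x\<bar> / U) powr p / p + (\<bar>v x\<bar> / V) powr q / q"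
        using UV pq by (intro Youngs_inequality) auto
      then have "U * V * ((\<bar>u x\<bar> / U) * (\<bar>v x\<bar> / V))
          \<le> U * V * ((\<bar>u x\<bar> / U) powr p / p + (\<bar>v x\<bar> / V) powr q / q)"
        using UV by (intro mult_left_mono) auto
      moreover have "U * V * ((\<bar>u x\<bar> / U) * (\<bar>v x\<bar> / V)) = \<bar>u x * v x\<bar>"
        using UV by (simp add: abs_mult)
      moreover have "U * V * ((\<bar>u x\<bar> / U) powr p / p + (\<bar>v x\<bar> / V) powr q / q)
          = a * \<bar>u x\<bar> powr p + b * \<bar>v x\<bar> powr q"
        using UV by (simp add: a_def b_def powr_divide distrib_left mult_ac)
      ultimately show ?thesis
        by simp
    qed
    then have "(\<integral>\<^sup>+x. ennreal \<bar>u x * v x\<bar> \<partial>M)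
        \<le> (\<integral>\<^sup>+x. ennreal a * ennreal (\<bar>u x\<bar> powr p) + ennreal b * ennreal (\<bar>v x\<bar> powr q) \<partial>M)"
      using ab by (intro nn_integral_mono) (simp flip: ennreal_mult ennreal_plus)
    also have "\<dots> = ennreal a * ennreal (U powr p) + ennreal b * ennreal (V powr q)"
      by (simp add: nn_integral_add nn_integral_cmult intU intV)
    also have "\<dots> = ennreal (a * U powr p + b * V powr q)"
      using ab by (simp add: ennreal_mult)
    also have "a * U powr p + b * V powr q = U * V * (1 / p + 1 / q)"
      using UV pq(1,2) by (simp add: a_def b_def distrib_left)
    also have "\<dots> = U * V"
      by (simp only: pq(3) mult_1_right)
    also have "ennreal (U * V) = Lp_norm M p u * Lp_norm M q v"
      using UV by (simp add: ennreal_mult)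
    finally show ?thesis .
  qed
qed

lemma Lp_norm_le_G_norm:
  assumes "\<psi> \<in> Psi A B" "p \<in> exp_interval A B"
  shows "Lp_norm M p f \<le> G_norm M A B \<psi> f * ennreal (\<psi> p)"
proof -
  have pos: "0 < \<psi> p"
    using assms by (auto simp: Psi_def)
  have "Lp_norm M p f / ennreal (\<psi> p) \<le> G_norm M A B \<psi> f"
    unfolding G_norm_def GL_norm_def
    by (rule SUP_upper2[OF assms(2)]) (use assms(2) in \<open>simp add: extend_infty_def\<close>)
  then have "Lp_norm M p f / ennreal (\<psi> p) * ennreal (\<psi> p) \<le> G_norm M A B \<psi> f * ennreal (\<psi> p)"
    by (rule mult_right_mono) simp
  then show ?thesis
    using pos by (simp add: ennreal_divide_times)
qed

lemma exp_interval_nonempty: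
  assumes "ereal a < b"
  shows "exp_interval a b \<noteq> {}"
proof -
  obtain r where "ereal a < ereal r" "ereal r < b"
    using ereal_dense2[OF assms] by blast
  then show ?thesis
    by (auto simp: exp_interval_def)
qed

lemma G_norm_eq_0_imp_AE:
  assumes "f \<in> borel_measurable M" "\<psi> \<in> Psi A B" "ereal A < B" "G_norm M A B \<psi> f = 0"
  shows "AE x in M. f x = 0"
proof -
  obtain p where "p \<in> exp_interval A B"
    using exp_interval_nonempty[OF assms(3)] by blast
  then have "Lp_norm M p f = 0"
    using Lp_norm_le_G_norm[OF assms(2), of p M f] assms(4) by simp
  then show ?thesis
    using assms(1) by (simp add: Lp_norm_eq_0_iff)
qed

section \<open>Composition with a map whose distribution has a density\<close>

text \<open>The integral of \<open>\<bar>f \<circ> \<xi>\<bar>\<^sup>p\<close> is that of \<open>\<bar>f\<bar>\<^sup>p * h\<close>, because the image of \<open>M\<close> under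
  \<open>\<xi>\<close> is the measure with density \<open>h\<close> (negative values of \<open>h\<close> count as \<open>0\<close>); Hoelder's
  inequality separates the two factors.\<close>

lemma Lp_norm_composition_op_le:
  assumes [measurable]: "f \<in> borel_measurable M" "h \<in> borel_measurable M" "\<xi> \<in> measurable M M"
    and density: "\<And>E. E \<in> sets M \<Longrightarrow>
      emeasure M {y \<in> space M. \<xi> y \<in> E} = (\<integral>\<^sup>+x\<in>E. ennreal (h x) \<partial>M)"
    and "0 < p" and conj: "1 < s" "1 < t" "1 / s + 1 / t = 1"
  shows "Lp_norm M p (composition_op \<xi> f) \<le> Lp_norm M (s * p) f * ennreal_powr (Lp_norm M t h) (1 / p)"
proof -
  have distr: "distr M M \<xi> = density M (\<lambda>x. ennreal (h x))"
  proof (rule measure_eqI)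
    fix E assume "E \<in> sets (distr M M \<xi>)"
    then have E[measurable]: "E \<in> sets M"
      by simp
    have "\<xi> -` E \<inter> space M = {y \<in> space M. \<xi> y \<in> E}"
      by auto
    then show "emeasure (distr M M \<xi>) E = emeasure (density M (\<lambda>x. ennreal (h x))) E"
      using density[OF E] by (simp add: emeasure_distr emeasure_density)
  qed simp
  have "(\<integral>\<^sup>+x. ennreal (\<bar>composition_op \<xi> f x\<bar> powr p) \<partial>M)
      = (\<integral>\<^sup>+x. ennreal (\<bar>f x\<bar> powr p) \<partial>distr M M \<xi>)"
    by (simp add: nn_integral_distr composition_op_def)
  also have "\<dots> = (\<integral>\<^sup>+x. ennreal (h x) * ennreal (\<bar>f x\<bar> powr p) \<partial>M)"
    unfolding distr by (simp add: nn_integral_density)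
  also have "\<dots> \<le> (\<integral>\<^sup>+x. ennreal \<bar>\<bar>f x\<bar> powr p * h x\<bar> \<partial>M)"
    by (intro nn_integral_mono)
       (auto simp: abs_mult ennreal_mult mult.commute intro!: mult_mono ennreal_leI)
  also have "\<dots> \<le> Lp_norm M s (\<lambda>x. \<bar>f x\<bar> powr p) * Lp_norm M t h"
    using conj by (intro nn_integral_mult_le_Lp_norm) auto
  also have "\<dots> = ennreal_powr (Lp_norm M (s * p) f) p * Lp_norm M t h"
    using assms by (simp add: Lp_norm_abs_powr)
  finally have "Lp_norm M p (composition_op \<xi> f)
      \<le> ennreal_powr (ennreal_powr (Lp_norm M (s * p) f) p * Lp_norm M t h) (1 / p)"
    unfolding Lp_norm_def[of M p] using \<open>0 < p\<close> by (intro ennreal_powr_mono) auto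
  also have "\<dots> = ennreal_powr (Lp_norm M (s * p) f) 1 * ennreal_powr (Lp_norm M t h) (1 / p)"
    using \<open>0 < p\<close> by (simp add: ennreal_powr_mult ennreal_powr_powr)
  also have "ennreal_powr (Lp_norm M (s * p) f) 1 = Lp_norm M (s * p) f"
    by (cases "Lp_norm M (s * p) f") (auto simp: ennreal_powr_ennreal ennreal_powr_top)
  finally show ?thesis .
qed

theorem theorem3p1:
  fixes M :: "'a measure" and \<xi> :: "'a \<Rightarrow> 'a" and h :: "'a \<Rightarrow> real"
    and \<psi> \<theta> :: "real \<Rightarrow> real" and A a c :: real and B b d :: ereal
    and \<nu> :: "real \<Rightarrow> ennreal"
  assumes "sigma_finite_measure M"
    and "emeasure M (space M) \<noteq> 0"
    and "\<xi> \<in> measurable M M"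
    and "h \<in> borel_measurable M"
    and "AE x in M. 0 \<le> h x"
    and "\<And>E. E \<in> sets M \<Longrightarrow>
           emeasure M {y \<in> space M. \<xi> y \<in> E} = (\<integral>\<^sup>+x\<in>E. ennreal (h x) \<partial>M)"
    and "1 \<le> A" and "ereal A < B" and "\<psi> \<in> Psi A B"
    and "1 \<le> a" and "ereal a < b" and "\<theta> \<in> Psi a b"
    and "h \<in> G_space M a b \<theta>"
    and "\<nu> = odot A B \<psi> a b \<theta> (G_norm M a b \<theta> h)"
    and "1 \<le> c" and "ereal c < d"
    and "\<forall>p\<in>exp_interval c d. \<nu> p < \<infinity>"
  shows "\<forall>f\<in>G_space M A B \<psi>.
           GL_norm M c d \<nu> (composition_op \<xi> f) \<le> G_norm M A B \<psi> f"
proof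
  fix f assume "f \<in> G_space M A B \<psi>"
  then have [measurable]: "f \<in> borel_measurable M" and F: "G_norm M A B \<psi> f < top"
    by (auto simp: G_space_def)
  define H where "H = G_norm M a b \<theta> h"
  have "H \<noteq> 0"
  proof
    assume "H = 0"
    then have "AE x in M. h x = 0"
      using G_norm_eq_0_imp_AE[OF assms(4,12,11)] by (simp add: H_def)
    then have "(\<integral>\<^sup>+x\<in>space M. ennreal (h x) \<partial>M) = (\<integral>\<^sup>+x. 0 \<partial>M)"
      by (intro nn_integral_cong_AE) auto
    moreover have "{y \<in> space M. \<xi> y \<in> space M} = space M"
      using measurable_space[OF assms(3)] by auto
    ultimately show False
      using assms(2) assms(6)[of "space M"] by simp
  qed
  show "GL_norm M c d \<nu> (composition_op \<xi> f) \<le> G_norm M A B \<psi> f"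
    unfolding GL_norm_def
  proof (rule SUP_least)
    fix p assume p: "p \<in> exp_interval c d"
    then have "0 < p"
      using assms(15) by (auto simp: exp_interval_def)
    have "\<nu> p < top"
      using assms(17) p by auto
    then show "Lp_norm M p (composition_op \<xi> f) / \<nu> p \<le> G_norm M A B \<psi> f"
      unfolding assms(14) odot_def H_def[symmetric]
    proof (rule ennreal_divide_INF_le[OF _ F])
      fix \<alpha> :: real assume "\<alpha> \<in> {1<..}"
      then have "1 < \<alpha>"
        by simp
      let ?t = "\<alpha> / (\<alpha> - 1)"
      assume fin: "extend_infty A B \<psi> (\<alpha> * p) * ennreal_powr (H * extend_infty a b \<theta> ?t) (1 / p) < top"
      \<comment> \<open>As both factors are nonzero, a finite product excludes exponents outside
          the supports of the two weights.\<close>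
      have "extend_infty A B \<psi> (\<alpha> * p) \<noteq> 0" "extend_infty a b \<theta> ?t \<noteq> 0"
        using assms(9,12) by (auto simp: extend_infty_def Psi_def ennreal_eq_0_iff not_le)
      with fin \<open>H \<noteq> 0\<close> have "extend_infty A B \<psi> (\<alpha> * p) \<noteq> top" "extend_infty a b \<theta> ?t \<noteq> top"
        by (auto simp: less_top[symmetric] ennreal_mult_eq_top_iff ennreal_powr_eq_0_iff
            ennreal_powr_eq_top_iff)
      then have supp: "\<alpha> * p \<in> exp_interval A B" "?t \<in> exp_interval a b"
        by (auto simp: extend_infty_def split: if_splits)
      have "Lp_norm M p (composition_op \<xi> f)
          \<le> Lp_norm M (\<alpha> * p) f * ennreal_powr (Lp_norm M ?t h) (1 / p)"
        using assms(3,4,6) \<open>0 < p\<close> \<open>1 < \<alpha>\<close>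
        by (intro Lp_norm_composition_op_le) (auto simp: field_simps)
      also have "\<dots> \<le> (G_norm M A B \<psi> f * ennreal (\<psi> (\<alpha> * p))) *
          ennreal_powr (H * ennreal (\<theta> ?t)) (1 / p)"
        unfolding H_def using \<open>0 < p\<close> supp assms(9,12)
        by (intro mult_mono ennreal_powr_mono Lp_norm_le_G_norm) auto
      finally show "Lp_norm M p (composition_op \<xi> f) \<le> G_norm M A B \<psi> f *
          (extend_infty A B \<psi> (\<alpha> * p) * ennreal_powr (H * extend_infty a b \<theta> ?t) (1 / p))"
        using supp by (simp add: extend_infty_def mult.assoc)
    qed
  qed
qed

end
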